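(* Let $C_x\subset\mathbb{R}^n$ and $C_u\subset\mathbb{R}^m$. Suppose the function $\mathcal{L}:\mathbb{R}^n\times\mathbb{R}^m\to\mathbb{R}$ is continuous and strictly convex in its second argument. Let the set-valued map $D:C_x\rightrightarrows C_u$ be continuous and have nonempty, compact and convex values. For each $x\in C_x$ define $$\kappa^*(x):=\operatorname*{arg\,min}_{u\in D(x)}\ \mathcal{L}(x,u).$$ Then $\kappa^*$ is single valued on $C_x$ (i.e., for each $x\in C_x$ there is exactly one minimizer) and $\kappa^*:C_x\to C_u$ is continuous.
   Context: A set-valued map $D:C_x\rightrightarrows C_u$ is outer semicontinuous at $x\in C_x$ if for all sequences $x_i\in C_x$, $x_i\to x$, and $y_i\in D(x_i)$ with $y_i\to y\in\mathbb{R}^m$, we have $y\in D(x)$. It is lower semicontinuous at $x\in C_x$ if for every open set $V$ with $D(x)\cap V\ne\emptyset$ there is a neighborhood $U(x)$ of $x$ with $D(z)\cap V\neq\emptyset$ for all $z\in U(x)\cap C_x$. It is continuous if it is both outer and lower semicontinuous at every $x\in C_x$. *)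

theory Defs
  imports "HOL-Analysis.Analysis"
begin

text \<open>
  A set-valued map with domain \<open>A\<close> is a function into sets whose values outside \<open>A\<close> are ignored.
\<close>

definition outer_semicontinuous_at ::
  "'a::topological_space set \<Rightarrow> ('a \<Rightarrow> 'b::topological_space set) \<Rightarrow> 'a \<Rightarrow> bool" where
  "outer_semicontinuous_at A D x \<longleftrightarrow>
    (\<forall>X Y y. (\<forall>i::nat. X i \<in> A) \<longrightarrow> X \<longlonglongrightarrow> x \<longrightarrow>
       (\<forall>i. Y i \<in> D (X i)) \<longrightarrow> Y \<longlonglongrightarrow> y \<longrightarrow> y \<in> D x)"

definition lower_semicontinuous_at ::
  "'a::topological_space set \<Rightarrow> ('a \<Rightarrow> 'b::topological_space set) \<Rightarrow> 'a \<Rightarrow> bool" where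
  "lower_semicontinuous_at A D x \<longleftrightarrow>
    (\<forall>V. open V \<longrightarrow> D x \<inter> V \<noteq> {} \<longrightarrow>
       (\<exists>U. open U \<and> x \<in> U \<and> (\<forall>z \<in> U \<inter> A. D z \<inter> V \<noteq> {})))"

definition continuous_set_valued_on ::
  "'a::topological_space set \<Rightarrow> ('a \<Rightarrow> 'b::topological_space set) \<Rightarrow> bool" where
  "continuous_set_valued_on A D \<longleftrightarrow>
    (\<forall>x\<in>A. outer_semicontinuous_at A D x \<and> lower_semicontinuous_at A D x)"

definition strictly_convex_on :: "'a::real_vector set \<Rightarrow> ('a \<Rightarrow> real) \<Rightarrow> bool" where
  "strictly_convex_on S f \<longleftrightarrow> convex S \<and>
    (\<forall>x\<in>S. \<forall>y\<in>S. x \<noteq> y \<longrightarrow> (\<forall>u>0. \<forall>v>0. u + v = 1 \<longrightarrow>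
       f (u *\<^sub>R x + v *\<^sub>R y) < u * f x + v * f y))"

text \<open>The set of all minimizers; it is the content of the theorem that it is a singleton.\<close>

definition kappa_star :: "('a \<times> 'b \<Rightarrow> real) \<Rightarrow> ('a \<Rightarrow> 'b set) \<Rightarrow> 'a \<Rightarrow> 'b set" where
  "kappa_star L D x = {u. is_arg_min (\<lambda>u. L (x, u)) (\<lambda>u. u \<in> D x) u}"

end

theory Submission
  imports Defs
begin

text \<open>
  A minimizer over \<open>D x\<close> exists by compactness, and strict convexity excludes a second one, since
  the midpoint of two minimizers would do better. The point of the theorem is the continuity of the
  minimizer, because the hypotheses do not mention any local boundedness of \<open>D\<close> that would keep
  the minimizers of nearby problems in a compact set.

  Convexity makes up for it. Let \<open>k z\<close> be the minimizer over \<open>D z\<close>, and suppose that points \<open>z\<close>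
  arbitrarily close to \<open>x\<close> have \<open>k z\<close> at distance at least \<open>e\<close> from \<open>k x\<close>. By lower semicontinuity
  there are feasible points \<open>y \<in> D z\<close> close to \<open>k x\<close>. The part of \<open>D z\<close> on which the cost is at
  most its value at \<open>y\<close> is convex, contains \<open>y\<close> and contains \<open>k z\<close>, so it meets the sphere of
  radius \<open>e\<close> about \<open>k x\<close>. That sphere is compact: a limit of such crossing points lies in \<open>D x\<close> by
  outer semicontinuity, costs no more than \<open>k x\<close>, and is different from \<open>k x\<close>, which contradicts
  the uniqueness of the minimizer. This is the lemma \<open>continuous_on_unique_minimizer\<close>.
\<close>

lemma strictly_convex_onD:
  assumes "strictly_convex_on S f" "x \<in> S" "y \<in> S" "x \<noteq> y" "u > 0" "v > 0" "u + v = 1"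
  shows "f (u *\<^sub>R x + v *\<^sub>R y) < u * f x + v * f y"
  using assms unfolding strictly_convex_on_def by blast

lemma convex_sublevel_of_strictly_convex_on:
  assumes "strictly_convex_on S f" "convex K" "K \<subseteq> S"
  shows "convex {w \<in> K. f w \<le> c}"
  unfolding convex_def
proof (intro ballI allI impI)
  fix a b and s t :: real
  assume ab: "a \<in> {w \<in> K. f w \<le> c}" "b \<in> {w \<in> K. f w \<le> c}"
    and st: "0 \<le> s" "0 \<le> t" "s + t = 1"
  have "s *\<^sub>R a + t *\<^sub>R b \<in> K"
    using ab st \<open>convex K\<close> by (auto simp: convex_def)
  moreover have "f (s *\<^sub>R a + t *\<^sub>R b) \<le> c"
  proof (cases "a = b \<or> s = 0 \<or> t = 0")
    case True
    then show ?thesis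
      using ab st by (auto simp flip: scaleR_add_left)
  next
    case False
    then have "f (s *\<^sub>R a + t *\<^sub>R b) < s * f a + t * f b"
      using strictly_convex_onD[OF assms(1), of a b s t] assms(3) ab st by auto
    also have "\<dots> \<le> c"
      using convex_bound_le[of "f a" c "f b" s t] ab st by auto
    finally show ?thesis by simp
  qed
  ultimately show "s *\<^sub>R a + t *\<^sub>R b \<in> {w \<in> K. f w \<le> c}" by simp
qed

lemma strictly_convex_on_minimizer_unique:
  assumes sc: "strictly_convex_on S f" and K: "convex K" "K \<subseteq> S"
    and a: "is_arg_min f (\<lambda>u. u \<in> K) a" and b: "is_arg_min f (\<lambda>u. u \<in> K) b"
  shows "a = b"
proof (rule ccontr)
  assume "a \<noteq> b"
  have ab: "a \<in> K" "b \<in> K" "f a = f b"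
    using a b by (auto simp: is_arg_min_linorder intro: antisym)
  let ?m = "(1/2) *\<^sub>R a + (1/2) *\<^sub>R b"
  have "f ?m < (1/2) * f a + (1/2) * f b"
    using strictly_convex_onD[OF sc, of a b "1/2" "1/2"] \<open>a \<noteq> b\<close> ab K by auto
  moreover have "?m \<in> K"
    using convexD[OF K(1) ab(1,2), of "1/2" "1/2"] by simp
  then have "f a \<le> f ?m"
    using a by (auto simp: is_arg_min_linorder)
  ultimately show False using ab by simp
qed

text \<open>
  Used to replace points of \<open>T\<close> that may be arbitrarily far from \<open>p\<close> by points of \<open>T\<close> in a fixed
  compact set, so that convergent subsequences exist. A sphere, unlike a closed ball, also keeps
  the limits away from \<open>p\<close>.
\<close>
lemma connected_meets_sphere:
  fixes p :: "'a::euclidean_space"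
  assumes "connected T" "y \<in> T" "dist p y < e" "k \<in> T" "e \<le> dist p k"
  obtains w where "w \<in> T" "w \<in> sphere p e"
proof -
  have "T \<inter> ball p e \<noteq> {}" "T - ball p e \<noteq> {}"
    using assms by auto
  then have "T \<inter> frontier (ball p e) \<noteq> {}"
    using connected_Int_frontier \<open>connected T\<close> by blast
  moreover have "e > 0"
    using assms(3) zero_le_dist[of p y] by linarith
  ultimately show thesis
    using that frontier_ball[of e p] by blast
qed

text \<open>
  The sublevel hypothesis provides the connected sets that cross the sphere about \<open>k x\<close>;
  the uniqueness hypothesis turns the limit of the crossing points into a contradiction.
\<close>
lemma continuous_on_unique_minimizer:
  fixes L :: "'a::metric_space \<times> 'b::euclidean_space \<Rightarrow> real"
  assumes L: "continuous_on UNIV L"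
    and D: "continuous_set_valued_on A D"
    and sublevel: "\<And>z c. z \<in> A \<Longrightarrow> convex {w \<in> D z. L (z, w) \<le> c}"
    and min: "\<And>z. z \<in> A \<Longrightarrow> is_arg_min (\<lambda>u. L (z, u)) (\<lambda>u. u \<in> D z) (k z)"
    and uniq: "\<And>z u. z \<in> A \<Longrightarrow> is_arg_min (\<lambda>u. L (z, u)) (\<lambda>u. u \<in> D z) u \<Longrightarrow> u = k z"
  shows "continuous_on A k"
proof (rule ccontr)
  assume "\<not> continuous_on A k"
  then obtain x e where x: "x \<in> A" and e: "e > 0"
    and far: "\<And>d. d > 0 \<Longrightarrow> \<exists>z\<in>A. dist z x < d \<and> e \<le> dist (k z) (k x)"
    unfolding continuous_on_iff by (metis not_le)
  have osc: "outer_semicontinuous_at A D x" and lsc: "lower_semicontinuous_at A D x"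
    using D x by (auto simp: continuous_set_valued_on_def)
  have kx: "k x \<in> D x" "\<And>u. u \<in> D x \<Longrightarrow> L (x, k x) \<le> L (x, u)"
    using min[OF x] by (auto simp: is_arg_min_linorder)
  \<comment> \<open>The minimum with \<open>e\<close> keeps the feasible points near \<open>k x\<close> strictly inside the sphere.\<close>
  define r :: "nat \<Rightarrow> real" where "r n = min e (1 / real (Suc n))" for n
  have r_pos: "r n > 0" for n
    using e by (simp add: r_def)
  have "\<exists>z y w. z \<in> A \<and> dist z x \<le> r n \<and> dist y (k x) \<le> r n \<and>
      w \<in> D z \<and> L (z, w) \<le> L (z, y) \<and> w \<in> sphere (k x) e" for n
  proof -
    have "D x \<inter> ball (k x) (r n) \<noteq> {}"
      using kx(1) r_pos[of n] by (metis IntI centre_in_ball empty_iff)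
    then obtain U where "open U" "x \<in> U"
      and U: "\<And>z. z \<in> U \<inter> A \<Longrightarrow> D z \<inter> ball (k x) (r n) \<noteq> {}"
      using lsc unfolding lower_semicontinuous_at_def by (meson open_ball)
    then obtain d where d: "d > 0" "ball x d \<subseteq> U"
      using open_contains_ball by blast
    obtain z where z: "z \<in> A" "dist z x < min d (r n)" "e \<le> dist (k z) (k x)"
      using far[of "min d (r n)"] d(1) r_pos[of n] by auto
    then have "z \<in> U \<inter> A"
      using d(2) by (auto simp: dist_commute)
    then obtain y where y: "y \<in> D z" "dist (k x) y < r n"
      using U[of z] by auto
    define T where "T = {w \<in> D z. L (z, w) \<le> L (z, y)}"
    have "connected T"
      unfolding T_def by (rule convex_connected[OF sublevel[OF z(1)]])
    moreover have "y \<in> T" "k z \<in> T"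
      using y min[OF z(1)] by (auto simp: T_def is_arg_min_linorder)
    moreover have "dist (k x) y < e"
      using y(2) by (simp add: r_def)
    ultimately obtain w where "w \<in> T" "w \<in> sphere (k x) e"
      using z(3) by (metis connected_meets_sphere dist_commute)
    then show ?thesis
      using z y(2) unfolding T_def
      by (intro exI[of _ z] exI[of _ y] exI[of _ w]) (auto simp: dist_commute)
  qed
  then obtain Z Y W where Z: "\<And>n. Z n \<in> A" "\<And>n. dist (Z n) x \<le> r n"
    and Y: "\<And>n. dist (Y n) (k x) \<le> r n"
    and W: "\<And>n. W n \<in> D (Z n)" "\<And>n. L (Z n, W n) \<le> L (Z n, Y n)" "\<And>n. W n \<in> sphere (k x) e"
    by metis
  have r_lim: "r \<longlonglongrightarrow> 0"
  proof (rule tendsto_sandwich[OF _ _ tendsto_const LIMSEQ_inverse_real_of_nat])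
    show "\<forall>\<^sub>F n in sequentially. 0 \<le> r n"
      using r_pos by (simp add: less_imp_le)
    show "\<forall>\<^sub>F n in sequentially. r n \<le> inverse (real (Suc n))"
      by (simp add: r_def inverse_eq_divide)
  qed
  have Zlim: "Z \<longlonglongrightarrow> x"
    by (rule metric_tendsto_imp_tendsto[OF r_lim]) (use Z r_pos in \<open>auto simp: less_imp_le abs_of_pos\<close>)
  have Ylim: "Y \<longlonglongrightarrow> k x"
    by (rule metric_tendsto_imp_tendsto[OF r_lim]) (use Y r_pos in \<open>auto simp: less_imp_le abs_of_pos\<close>)
  obtain w \<sigma> where w: "w \<in> sphere (k x) e" and \<sigma>: "strict_mono \<sigma>" and Wlim: "(W \<circ> \<sigma>) \<longlonglongrightarrow> w"
    using compact_sphere[of "k x" e] W(3) unfolding compact_def by metis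
  have Zlim': "(Z \<circ> \<sigma>) \<longlonglongrightarrow> x" and Ylim': "(Y \<circ> \<sigma>) \<longlonglongrightarrow> k x"
    using Zlim Ylim \<sigma> by (simp_all add: LIMSEQ_subseq_LIMSEQ)
  have "w \<in> D x"
    using osc[unfolded outer_semicontinuous_at_def, rule_format, of "Z \<circ> \<sigma>" "W \<circ> \<sigma>" w]
      Z(1) W(1) Zlim' Wlim by simp
  moreover have "L (x, w) \<le> L (x, k x)"
  proof (rule LIMSEQ_le)
    have lim: "(\<lambda>n. L (f n)) \<longlonglongrightarrow> L l" if "f \<longlonglongrightarrow> l" for f l
      using continuous_on_tendsto_compose[OF L that] by simp
    show "(\<lambda>n. L ((Z \<circ> \<sigma>) n, (W \<circ> \<sigma>) n)) \<longlonglongrightarrow> L (x, w)"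
      by (rule lim[OF tendsto_Pair[OF Zlim' Wlim]])
    show "(\<lambda>n. L ((Z \<circ> \<sigma>) n, (Y \<circ> \<sigma>) n)) \<longlonglongrightarrow> L (x, k x)"
      by (rule lim[OF tendsto_Pair[OF Zlim' Ylim']])
  qed (use W(2) in auto)
  ultimately have "is_arg_min (\<lambda>u. L (x, u)) (\<lambda>u. u \<in> D x) w"
    using kx(2) by (fastforce simp: is_arg_min_linorder)
  then have "w = k x"
    by (rule uniq[OF x])
  then show False
    using w e by simp
qed

theorem lemma2:
  fixes Cx :: "(real ^ 'n) set"
    and Cu :: "(real ^ 'm) set"
    and L :: "(real ^ 'n) \<times> (real ^ 'm) \<Rightarrow> real"
    and D :: "real ^ 'n \<Rightarrow> (real ^ 'm) set"
  assumes "continuous_on UNIV L"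
    and "\<And>x. strictly_convex_on UNIV (\<lambda>u. L (x, u))"
    and "\<And>x. x \<in> Cx \<Longrightarrow> D x \<subseteq> Cu"
    and "continuous_set_valued_on Cx D"
    and "\<And>x. x \<in> Cx \<Longrightarrow> D x \<noteq> {} \<and> compact (D x) \<and> convex (D x)"
  shows "(\<forall>x\<in>Cx. \<exists>!u. u \<in> kappa_star L D x) \<and>
    (\<lambda>x. the_elem (kappa_star L D x)) ` Cx \<subseteq> Cu \<and>
    continuous_on Cx (\<lambda>x. the_elem (kappa_star L D x))"
proof -
  let ?k = "\<lambda>x. the_elem (kappa_star L D x)"
  have uniq: "a = b" if "x \<in> Cx" "a \<in> kappa_star L D x" "b \<in> kappa_star L D x" for x a b
    using strictly_convex_on_minimizer_unique[OF assms(2)[of x], of "D x" a b] assms(5)[of x] that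
    by (simp add: kappa_star_def)
  have ex1: "\<exists>!u. u \<in> kappa_star L D x" if x: "x \<in> Cx" for x
  proof (rule ex_ex1I)
    have "continuous_on (D x) (\<lambda>u. L (x, u))"
      by (intro continuous_on_compose2[OF assms(1)] continuous_intros) auto
    then show "\<exists>u. u \<in> kappa_star L D x"
      using continuous_attains_inf[of "D x" "\<lambda>u. L (x, u)"] assms(5)[OF x]
      by (auto simp: kappa_star_def is_arg_min_linorder)
  qed (rule uniq[OF x])
  have k: "?k x \<in> kappa_star L D x" if x: "x \<in> Cx" for x
  proof -
    obtain u where "u \<in> kappa_star L D x"
      using ex1[OF x] by blast
    moreover from this have "kappa_star L D x = {u}"
      using uniq[OF x] by blast
    ultimately show ?thesis by simp
  qed
  have "continuous_on Cx ?k"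
  proof (rule continuous_on_unique_minimizer[OF assms(1,4)])
    show "convex {w \<in> D z. L (z, w) \<le> c}" if "z \<in> Cx" for z c
      by (rule convex_sublevel_of_strictly_convex_on[OF assms(2)]) (use assms(5)[OF that] in auto)
    show "is_arg_min (\<lambda>u. L (z, u)) (\<lambda>u. u \<in> D z) (?k z)" if "z \<in> Cx" for z
      using k[OF that] by (simp add: kappa_star_def)
    show "u = ?k z" if "z \<in> Cx" "is_arg_min (\<lambda>u. L (z, u)) (\<lambda>u. u \<in> D z) u" for z u
      using uniq[OF that(1) _ k[OF that(1)]] that(2) by (simp add: kappa_star_def)
  qed
  moreover have "?k ` Cx \<subseteq> Cu"
    using k assms(3) by (fastforce simp: kappa_star_def is_arg_min_linorder)
  ultimately show ?thesis
    using ex1 by blast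
qed

end
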